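(* Let $C$ be a curve in a Myller configuration $M(C,\bar\xi,\pi)$ with Frenet-type frame $R_F=\{P(s);\bar\xi_1,\bar\xi_2,\bar\xi_3\}$ and (nowhere) non-zero curvatures $K_1,K_2$. Then $C$ is a $\bar\xi_1$-helix (equivalently, a $\bar\xi_3$-helix) if and only if $$\bar\xi_2''+K_1\left(\frac1{K_1}\right)'\bar\xi_2'+(K_1^2+K_2^2)\bar\xi_2=0.$$
   Context: All data are smooth. Let $C$ be a curve in Euclidean space $E^3$ with arclength parameter $s\in I$ ($I$ an interval) and position vector $\bar r(s)$, let $\bar\xi(s)$ be a unit vector field along $C$ (a versor field $(C,\bar\xi)$), and let $\pi(s)$ be a plane field along $C$ with $\bar\xi(s)\in\pi(s)$. The pair $((C,\bar\xi),(C,\pi))$ is called a Myller configuration $M=M(C,\bar\xi,\pi)$. Put $\bar\xi_1=\bar\xi$, $K_1=\|d\bar\xi/ds\|>0$ (curvature), define $\bar\xi_2$ by $\bar\xi_1'=K_1\bar\xi_2$, and $\bar\xi_3=\bar\xi_1\times\bar\xi_2$. Then $R_F=\{P(s);\bar\xi_1,\bar\xi_2,\bar\xi_3\}$ is a positively oriented orthonormal frame, the Frenet-type frame, and $$\bar\xi_1'=K_1\bar\xi_2,\quad \bar\xi_2'=-K_1\bar\xi_1+K_2\bar\xi_3,\quad \bar\xi_3'=-K_2\bar\xi_2,$$ which defines the torsion $K_2$. A prime denotes $d/ds$. The curve $C$ is called a $\bar\xi_i$-helix ($i=1,2,3$) if $\bar\xi_i$ makes a constant angle with a constant direction (a fixed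 unit vector). *)

theory Defs
  imports "HOL-Analysis.Analysis"
begin

text \<open>
  Derivatives are taken within the parameter interval \<open>I\<close>, hence are one-sided at those endpoints
  that belong to \<open>I\<close>. They are unique because \<open>I\<close> is nondegenerate.
\<close>

definition deriv_on :: "real set \<Rightarrow> (real \<Rightarrow> 'a::real_normed_vector) \<Rightarrow> real \<Rightarrow> 'a" where
  "deriv_on I f = (\<lambda>s. vector_derivative f (at s within I))"

definition smooth_on :: "real set \<Rightarrow> (real \<Rightarrow> 'a::real_normed_vector) \<Rightarrow> bool" where
  "smooth_on I f \<longleftrightarrow> (\<forall>n. ((deriv_on I ^^ n) f) differentiable_on I)"

text \<open>
  A plane is represented by its two-dimensional direction space, so that a versor lies in it as a
  free vector. Smoothness is expressed by a smooth unit normal field.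
\<close>

definition smooth_plane_field :: "real set \<Rightarrow> (real \<Rightarrow> (real^3) set) \<Rightarrow> bool" where
  "smooth_plane_field I \<pi> \<longleftrightarrow>
     (\<exists>\<nu>. smooth_on I \<nu> \<and> (\<forall>s\<in>I. norm (\<nu> s) = 1 \<and> \<pi> s = {v. v \<bullet> \<nu> s = 0}))"

definition myller_configuration ::
  "real set \<Rightarrow> (real \<Rightarrow> real^3) \<Rightarrow> (real \<Rightarrow> real^3) \<Rightarrow> (real \<Rightarrow> (real^3) set) \<Rightarrow> bool" where
  "myller_configuration I r \<xi> \<pi> \<longleftrightarrow>
     is_interval I \<and> interior I \<noteq> {} \<and>
     smooth_on I r \<and> (\<forall>s\<in>I. norm (deriv_on I r s) = 1) \<and>
     smooth_on I \<xi> \<and> (\<forall>s\<in>I. norm (\<xi> s) = 1) \<and>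
     smooth_plane_field I \<pi> \<and> (\<forall>s\<in>I. \<xi> s \<in> \<pi> s)"

text \<open>The Frenet-type frame of a versor field; its first vector is \<open>\<xi>\<close> itself.\<close>

definition K1 :: "real set \<Rightarrow> (real \<Rightarrow> real^3) \<Rightarrow> real \<Rightarrow> real" where
  "K1 I \<xi> s = norm (deriv_on I \<xi> s)"

definition xi2 :: "real set \<Rightarrow> (real \<Rightarrow> real^3) \<Rightarrow> real \<Rightarrow> real^3" where
  "xi2 I \<xi> s = (1 / K1 I \<xi> s) *\<^sub>R deriv_on I \<xi> s"

definition xi3 :: "real set \<Rightarrow> (real \<Rightarrow> real^3) \<Rightarrow> real \<Rightarrow> real^3" where
  "xi3 I \<xi> s = cross3 (\<xi> s) (xi2 I \<xi> s)"

text \<open>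
  The torsion is the coefficient of the third frame vector in the derivative of the second one;
  the lemma \<open>frenet_equations\<close> below confirms that it is the one in the Frenet equations.
\<close>

definition K2 :: "real set \<Rightarrow> (real \<Rightarrow> real^3) \<Rightarrow> real \<Rightarrow> real" where
  "K2 I \<xi> s = deriv_on I (xi2 I \<xi>) s \<bullet> xi3 I \<xi> s"

definition angle_between :: "real^3 \<Rightarrow> real^3 \<Rightarrow> real" where
  "angle_between u v = arccos ((u \<bullet> v) / (norm u * norm v))"

definition helix_of :: "real set \<Rightarrow> (real \<Rightarrow> real^3) \<Rightarrow> bool" where
  "helix_of I V \<longleftrightarrow> (\<exists>d \<theta>. norm d = 1 \<and> (\<forall>s\<in>I. angle_between (V s) d = \<theta>))"

lemma interval_at_within_neq_bot:
  fixes I :: "real set"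
  assumes "is_interval I" "interior I \<noteq> {}" "s \<in> I"
  shows "at s within I \<noteq> bot"
proof -
  have "connected I" using assms(1) by (simp add: is_interval_connected)
  moreover have "aff_dim I \<noteq> 0"
    using assms(2) by (metis aff_dim_eq_0 interior_singleton)
  ultimately have "s islimpt I"
    using assms(3) by (rule connected_imp_perfect_aff_dim)
  then show ?thesis by (simp add: trivial_limit_within)
qed

lemma orthonormal_expansion:
  fixes a b v :: "real^3"
  assumes "a \<bullet> a = 1" "b \<bullet> b = 1" "a \<bullet> b = 0"
  shows "v = (v \<bullet> a) *\<^sub>R a + (v \<bullet> b) *\<^sub>R b + (v \<bullet> cross3 a b) *\<^sub>R cross3 a b"
proof -
  define c where "c = cross3 a b"
  define w where "w = v - ((v \<bullet> a) *\<^sub>R a + (v \<bullet> b) *\<^sub>R b + (v \<bullet> c) *\<^sub>R c)"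
  have "norm c ^ 2 = 1"
    using norm_cross_dot[of a b] assms by (simp add: c_def flip: norm_eq_1)
  then have cc: "c \<bullet> c = 1" by (simp add: power2_norm_eq_inner)
  have ac: "a \<bullet> c = 0" "b \<bullet> c = 0" "c \<bullet> a = 0" "c \<bullet> b = 0"
    by (simp_all add: c_def dot_cross_self inner_commute)
  have ba: "b \<bullet> a = 0" using assms(3) by (simp add: inner_commute)
  have w: "w \<bullet> a = 0" "w \<bullet> b = 0" "w \<bullet> c = 0"
    using assms ac cc ba by (simp_all add: w_def inner_diff_left inner_add_left)
  have "cross3 w c = (w \<bullet> b) *\<^sub>R a - (w \<bullet> a) *\<^sub>R b"
    unfolding c_def by (rule Lagrange)
  then have "cross3 w c = 0" using w by simp
  then have "w = 0"
    using w(3) cc norm_and_cross_eq_0[of w c] by auto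
  then show ?thesis by (simp add: w_def c_def)
qed

lemma frenet_equations:
  assumes M: "myller_configuration I r \<xi> \<pi>"
    and K1_pos: "\<And>s. s \<in> I \<Longrightarrow> K1 I \<xi> s > 0"
    and s: "s \<in> I"
  shows "deriv_on I \<xi> s = K1 I \<xi> s *\<^sub>R xi2 I \<xi> s"
    and "deriv_on I (xi2 I \<xi>) s = - K1 I \<xi> s *\<^sub>R \<xi> s + K2 I \<xi> s *\<^sub>R xi3 I \<xi> s"
    and "deriv_on I (xi3 I \<xi>) s = - K2 I \<xi> s *\<^sub>R xi2 I \<xi> s"
    and "norm (\<xi> s) = 1" "norm (xi2 I \<xi> s) = 1" "norm (xi3 I \<xi> s) = 1"
    and "\<xi> s \<bullet> xi2 I \<xi> s = 0" "\<xi> s \<bullet> xi3 I \<xi> s = 0" "xi2 I \<xi> s \<bullet> xi3 I \<xi> s = 0"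
proof -
  let ?F = "at s within I"
  have sm: "smooth_on I \<xi>" and unit: "\<And>t. t \<in> I \<Longrightarrow> norm (\<xi> t) = 1"
    and nb: "\<And>t. t \<in> I \<Longrightarrow> at t within I \<noteq> bot"
    using M interval_at_within_neq_bot by (auto simp: myller_configuration_def)
  have const: "D = 0" if "(f has_vector_derivative D) (at t within I)"
      "\<And>u. u \<in> I \<Longrightarrow> f u = c" "t \<in> I" for f :: "real \<Rightarrow> real" and D c t
  proof -
    have "(f has_vector_derivative 0) (at t within I)"
      by (rule has_vector_derivative_transform[where f = "\<lambda>_. c"]) (use that in auto)
    then show ?thesis using that nb vector_derivative_unique_within by blast
  qed
  have d0: "(\<xi> has_vector_derivative deriv_on I \<xi> t) (at t within I)" if "t \<in> I" for t
    using sm[unfolded smooth_on_def, rule_format, of 0] that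
    by (simp add: deriv_on_def differentiable_on_def vector_derivative_works)
  have d1: "deriv_on I \<xi> differentiable (at t within I)" if "t \<in> I" for t
    using sm[unfolded smooth_on_def, rule_format, of 1] that
    by (simp add: differentiable_on_def)
  have T0: "deriv_on I \<xi> t \<noteq> 0" if "t \<in> I" for t
    using K1_pos[OF that] by (auto simp: K1_def)
  have K1d: "K1 I \<xi> differentiable ?F"
  proof -
    have "(norm \<circ> deriv_on I \<xi>) differentiable ?F"
      by (rule differentiable_chain_within[OF d1[OF s]])
        (use T0[OF s] differentiable_norm_at differentiable_at_withinI in blast)
    then show ?thesis by (simp add: K1_def[abs_def] comp_def)
  qed
  have "(\<lambda>t. (1 / K1 I \<xi> t) *\<^sub>R deriv_on I \<xi> t) differentiable ?F"
    using K1d d1[OF s] K1_pos[OF s] by (intro differentiable_scaleR differentiable_divide) auto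
  then have "xi2 I \<xi> differentiable ?F" by (simp add: xi2_def[abs_def])
  then have e: "(xi2 I \<xi> has_vector_derivative deriv_on I (xi2 I \<xi>) s) ?F"
    by (simp add: deriv_on_def vector_derivative_works)
  show T: "deriv_on I \<xi> s = K1 I \<xi> s *\<^sub>R xi2 I \<xi> s"
    using K1_pos[OF s] by (simp add: xi2_def)
  have n2: "norm (xi2 I \<xi> t) = 1" if "t \<in> I" for t
    using T0[OF that] by (simp add: xi2_def K1_def)
  have o12: "\<xi> t \<bullet> xi2 I \<xi> t = 0" if "t \<in> I" for t
  proof -
    have "((\<lambda>u. \<xi> u \<bullet> \<xi> u) has_vector_derivative
        \<xi> t \<bullet> deriv_on I \<xi> t + deriv_on I \<xi> t \<bullet> \<xi> t) (at t within I)"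
      by (rule bounded_bilinear.has_vector_derivative[OF bounded_bilinear_inner d0 d0]) fact+
    then have "\<xi> t \<bullet> deriv_on I \<xi> t + deriv_on I \<xi> t \<bullet> \<xi> t = 0"
      by (rule const[where c = 1]) (use unit that in \<open>auto simp: norm_eq_1\<close>)
    then show ?thesis by (simp add: xi2_def inner_commute)
  qed
  let ?e = "deriv_on I (xi2 I \<xi>) s"
  have "((\<lambda>u. xi2 I \<xi> u \<bullet> xi2 I \<xi> u) has_vector_derivative
      xi2 I \<xi> s \<bullet> ?e + ?e \<bullet> xi2 I \<xi> s) ?F"
    by (rule bounded_bilinear.has_vector_derivative[OF bounded_bilinear_inner e e])
  then have "xi2 I \<xi> s \<bullet> ?e + ?e \<bullet> xi2 I \<xi> s = 0"
    by (rule const[where c = 1]) (use n2 s in \<open>auto simp: norm_eq_1\<close>)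
  then have e2: "?e \<bullet> xi2 I \<xi> s = 0" by (simp add: inner_commute)
  have "((\<lambda>u. \<xi> u \<bullet> xi2 I \<xi> u) has_vector_derivative
      \<xi> s \<bullet> ?e + deriv_on I \<xi> s \<bullet> xi2 I \<xi> s) ?F"
    by (rule bounded_bilinear.has_vector_derivative[OF bounded_bilinear_inner d0[OF s] e])
  then have "\<xi> s \<bullet> ?e + deriv_on I \<xi> s \<bullet> xi2 I \<xi> s = 0"
    by (rule const[where c = 0]) (use o12 s in auto)
  then have e1: "?e \<bullet> \<xi> s = - K1 I \<xi> s"
    using n2[OF s] by (simp add: T inner_commute norm_eq_1)
  have on: "\<xi> s \<bullet> \<xi> s = 1" "xi2 I \<xi> s \<bullet> xi2 I \<xi> s = 1" "\<xi> s \<bullet> xi2 I \<xi> s = 0"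
    using unit n2 o12 s by (auto simp: norm_eq_1)
  show E: "?e = - K1 I \<xi> s *\<^sub>R \<xi> s + K2 I \<xi> s *\<^sub>R xi3 I \<xi> s"
    using orthonormal_expansion[OF on, of ?e] e1 e2
    by (simp add: K2_def xi3_def)
  have bb: "bounded_bilinear cross3"
    using bilinear_conv_bounded_bilinear bilinear_cross by blast
  have "(xi3 I \<xi> has_vector_derivative
      cross3 (\<xi> s) ?e + cross3 (deriv_on I \<xi> s) (xi2 I \<xi> s)) ?F"
    using bounded_bilinear.has_vector_derivative[OF bb d0[OF s] e]
    by (simp add: xi3_def[abs_def])
  then have "deriv_on I (xi3 I \<xi>) s = cross3 (\<xi> s) ?e + cross3 (deriv_on I \<xi> s) (xi2 I \<xi> s)"
    unfolding deriv_on_def[of I "xi3 I \<xi>"] by (rule vector_derivative_within[OF nb[OF s]])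
  also have "\<dots> = K2 I \<xi> s *\<^sub>R cross3 (\<xi> s) (xi3 I \<xi> s)"
    by (simp add: E T bounded_bilinear.diff_right[OF bb] cross_mult_left cross_mult_right)
  also have "cross3 (\<xi> s) (xi3 I \<xi> s) = - xi2 I \<xi> s"
    using Lagrange[of "\<xi> s" "\<xi> s" "xi2 I \<xi> s"] on by (simp add: xi3_def)
  finally show "deriv_on I (xi3 I \<xi>) s = - K2 I \<xi> s *\<^sub>R xi2 I \<xi> s" by simp
  show "norm (\<xi> s) = 1" "norm (xi2 I \<xi> s) = 1" "\<xi> s \<bullet> xi2 I \<xi> s = 0"
    using unit n2 o12 s by auto
  have "norm (xi3 I \<xi> s) ^ 2 = 1"
    using norm_cross_dot[of "\<xi> s" "xi2 I \<xi> s"] unit n2 o12 s by (simp add: xi3_def)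
  then show "norm (xi3 I \<xi> s) = 1"
    by (simp add: norm_eq_1 power2_norm_eq_inner)
  show "\<xi> s \<bullet> xi3 I \<xi> s = 0" "xi2 I \<xi> s \<bullet> xi3 I \<xi> s = 0"
    by (simp_all add: xi3_def dot_cross_self)
qed

end

theory Submission
  imports Defs
begin

text \<open>
  The statement is Lancret's theorem in differential form. Differentiating
  \<open>\<xi>\<^sub>2' = - K\<^sub>1 \<xi>\<^sub>1 + K\<^sub>2 \<xi>\<^sub>3\<close> once more and inserting the Frenet equations, the components along
  \<open>\<xi>\<^sub>1\<close> and \<open>\<xi>\<^sub>2\<close> of the left-hand side of the equation cancel, and what remains is
  \<open>K\<^sub>1 (K\<^sub>2 / K\<^sub>1)' \<xi>\<^sub>3\<close>. On an interval the equation therefore says that \<open>K\<^sub>2\<close> is a constant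
  multiple of \<open>K\<^sub>1\<close> (lemma \<open>equation_iff_proportional\<close>).

  Proportionality characterises helices (lemma \<open>constant_slope_iff_proportional\<close>). If
  \<open>\<xi>\<^sub>1 \<bullet> d\<close> is constant, then differentiating gives \<open>\<xi>\<^sub>2 \<bullet> d = 0\<close>, so \<open>\<xi>\<^sub>3 \<bullet> d\<close> is constant as
  well, and differentiating \<open>\<xi>\<^sub>2 \<bullet> d = 0\<close> gives \<open>K\<^sub>1 (\<xi>\<^sub>1 \<bullet> d) = K\<^sub>2 (\<xi>\<^sub>3 \<bullet> d)\<close>. Conversely, if
  \<open>K\<^sub>2 = c K\<^sub>1\<close>, then \<open>c \<xi>\<^sub>1 + \<xi>\<^sub>3\<close> is a constant vector, and it spans the axis.

  The case of \<open>\<xi>\<^sub>3\<close> needs no second computation: \<open>(\<xi>\<^sub>3, - \<xi>\<^sub>2, \<xi>\<^sub>1)\<close> satisfies the Frenet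
  equations with the two curvatures exchanged.
\<close>

section \<open>Differentiation along an interval\<close>

lemma constant_on_interval_iff_zero_derivative:
  fixes f :: "real \<Rightarrow> 'a::real_normed_vector"
  assumes "is_interval I" "interior I \<noteq> {}"
    and f: "\<And>s. s \<in> I \<Longrightarrow> (f has_vector_derivative f' s) (at s within I)"
  shows "(\<exists>c. \<forall>s\<in>I. f s = c) \<longleftrightarrow> (\<forall>s\<in>I. f' s = 0)"
proof
  assume "\<exists>c. \<forall>s\<in>I. f s = c"
  then obtain c where c: "\<And>s. s \<in> I \<Longrightarrow> f s = c" by blast
  show "\<forall>s\<in>I. f' s = 0"
  proof
    fix s assume s: "s \<in> I"
    have "(f has_vector_derivative 0) (at s within I)"
      by (rule has_vector_derivative_transform[where f = "\<lambda>_. c"]) (use s c in auto)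
    then show "f' s = 0"
      using vector_derivative_unique_within[OF interval_at_within_neq_bot] assms s by blast
  qed
next
  assume "\<forall>s\<in>I. f' s = 0"
  then show "\<exists>c. \<forall>s\<in>I. f s = c"
    using has_vector_derivative_zero_constant[of I f] f is_interval_convex[OF assms(1)]
    by metis
qed

lemma deriv_on_eqI:
  assumes "is_interval I" "interior I \<noteq> {}" "s \<in> I"
    and "(f has_vector_derivative D) (at s within I)"
  shows "deriv_on I f s = D"
  unfolding deriv_on_def
  by (rule vector_derivative_within) (use assms interval_at_within_neq_bot in auto)

lemma has_vector_derivative_deriv_on:
  "f differentiable (at s within I) \<Longrightarrow>
    (f has_vector_derivative deriv_on I f s) (at s within I)"
  by (simp add: deriv_on_def vector_derivative_works)

section \<open>Frames satisfying the Frenet equations\<close>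

text \<open>
  The expansion of every vector, in place of \<open>e3 = e1 \<times> e2\<close>, makes sense in any inner product
  space and is visibly symmetric under exchanging \<open>e1\<close> with \<open>e3\<close> and reversing \<open>e2\<close>.
\<close>

locale frenet_frame =
  fixes I :: "real set" and e1 e2 e3 :: "real \<Rightarrow> 'a::real_inner" and k1 k2 :: "real \<Rightarrow> real"
  assumes interval: "is_interval I" "interior I \<noteq> {}"
    and e1': "s \<in> I \<Longrightarrow> (e1 has_vector_derivative k1 s *\<^sub>R e2 s) (at s within I)"
    and e2': "s \<in> I \<Longrightarrow>
      (e2 has_vector_derivative - k1 s *\<^sub>R e1 s + k2 s *\<^sub>R e3 s) (at s within I)"
    and e3': "s \<in> I \<Longrightarrow> (e3 has_vector_derivative - k2 s *\<^sub>R e2 s) (at s within I)"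
    and unit: "s \<in> I \<Longrightarrow> norm (e1 s) = 1" "s \<in> I \<Longrightarrow> norm (e3 s) = 1"
    and orthogonal: "s \<in> I \<Longrightarrow> e1 s \<bullet> e3 s = 0"
    and expansion: "s \<in> I \<Longrightarrow> v = (v \<bullet> e1 s) *\<^sub>R e1 s + (v \<bullet> e2 s) *\<^sub>R e2 s + (v \<bullet> e3 s) *\<^sub>R e3 s"
begin

lemma reversed_frame: "frenet_frame I e3 (\<lambda>s. - e2 s) e1 k2 k1"
proof
  show "is_interval I" "interior I \<noteq> {}" by (fact interval)+
next
  fix s v assume s: "s \<in> I"
  show "(e3 has_vector_derivative k2 s *\<^sub>R - e2 s) (at s within I)"
    "(e1 has_vector_derivative - k1 s *\<^sub>R - e2 s) (at s within I)"
    using e3'[OF s] e1'[OF s] by simp_all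
  show "((\<lambda>s. - e2 s) has_vector_derivative - k2 s *\<^sub>R e3 s + k1 s *\<^sub>R e1 s) (at s within I)"
    using has_vector_derivative_minus[OF e2'[OF s]] by simp
  show "norm (e3 s) = 1" "norm (e1 s) = 1" using unit s by auto
  show "e3 s \<bullet> e1 s = 0" using orthogonal[OF s] by (simp add: inner_commute)
  show "v = (v \<bullet> e3 s) *\<^sub>R e3 s + (v \<bullet> - e2 s) *\<^sub>R - e2 s + (v \<bullet> e1 s) *\<^sub>R e1 s"
    using expansion[OF s, of v] by (simp add: add.commute add.left_commute)
qed

lemma inner_derivative:
  assumes "(f has_vector_derivative D) (at s within I)"
  shows "((\<lambda>t. f t \<bullet> d) has_vector_derivative D \<bullet> d) (at s within I)"
  using bounded_linear.has_vector_derivative[OF bounded_linear_inner_left assms] .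

text \<open>
  Lancret's theorem. The axis is orthogonal to \<open>e2\<close>, hence lies in the plane of \<open>e1\<close> and \<open>e3\<close>;
  its coordinates there are constant and stand in the ratio \<open>k2 : k1\<close>.
\<close>

lemma constant_slope_iff_proportional:
  assumes k1: "\<And>s. s \<in> I \<Longrightarrow> k1 s \<noteq> 0"
  shows "(\<exists>d. norm d = 1 \<and> (\<exists>a. \<forall>s\<in>I. e1 s \<bullet> d = a)) \<longleftrightarrow> (\<exists>c. \<forall>s\<in>I. k2 s = c * k1 s)"
proof
  assume "\<exists>d. norm d = 1 \<and> (\<exists>a. \<forall>s\<in>I. e1 s \<bullet> d = a)"
  then obtain d a where d: "norm d = 1" and a: "\<forall>s\<in>I. e1 s \<bullet> d = a" by blast
  note zero_deriv = constant_on_interval_iff_zero_derivative[OF interval inner_derivative]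
  have "\<forall>s\<in>I. (k1 s *\<^sub>R e2 s) \<bullet> d = 0"
    using zero_deriv[OF e1'] a by blast
  then have e2d: "\<forall>s\<in>I. e2 s \<bullet> d = 0" using k1 by simp
  have "\<forall>s\<in>I. (- k2 s *\<^sub>R e2 s) \<bullet> d = 0" using e2d by simp
  then obtain b where b: "\<forall>s\<in>I. e3 s \<bullet> d = b"
    using zero_deriv[OF e3'] by blast
  have "\<forall>s\<in>I. (- k1 s *\<^sub>R e1 s + k2 s *\<^sub>R e3 s) \<bullet> d = 0"
    using zero_deriv[OF e2'] e2d by blast
  then have rel: "k1 s * a = k2 s * b" if "s \<in> I" for s
    using that a b by (auto simp: inner_add_left inner_diff_left)
  have "k2 s = (a / b) * k1 s" if s: "s \<in> I" for s
  proof -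
    \<comment> \<open>otherwise \<open>d\<close> would be orthogonal to the whole frame\<close>
    have "b \<noteq> 0"
    proof
      assume "b = 0"
      then have "a = 0" using rel[OF s] k1[OF s] by simp
      then have "d = 0"
        using expansion[OF s, of d] a b e2d s \<open>b = 0\<close> by (simp add: inner_commute)
      then show False using d by simp
    qed
    then show ?thesis using rel[OF s] by (simp add: field_simps)
  qed
  then show "\<exists>c. \<forall>s\<in>I. k2 s = c * k1 s" by blast
next
  assume "\<exists>c. \<forall>s\<in>I. k2 s = c * k1 s"
  then obtain c where c: "\<And>s. s \<in> I \<Longrightarrow> k2 s = c * k1 s" by blast
  have D: "((\<lambda>t. c *\<^sub>R e1 t + e3 t) has_vector_derivative
      c *\<^sub>R k1 s *\<^sub>R e2 s + - k2 s *\<^sub>R e2 s) (at s within I)" if "s \<in> I" for s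
    using e1'[OF that] e3'[OF that]
    by (intro has_vector_derivative_add
        bounded_linear.has_vector_derivative[OF bounded_linear_scaleR_right])
  have "\<forall>s\<in>I. c *\<^sub>R k1 s *\<^sub>R e2 s + - k2 s *\<^sub>R e2 s = 0" using c by simp
  then obtain w where w: "\<And>s. s \<in> I \<Longrightarrow> c *\<^sub>R e1 s + e3 s = w"
    using constant_on_interval_iff_zero_derivative[OF interval D] by blast
  have e1w: "e1 s \<bullet> w = c" if "s \<in> I" for s
    using unit(1)[OF that] orthogonal[OF that]
    by (simp add: w[OF that, symmetric] inner_add_right norm_eq_1)
  obtain s0 where s0: "s0 \<in> I" using interval(2) interior_subset by blast
  have "e3 s0 \<bullet> w = 1"
    using unit(2)[OF s0] orthogonal[OF s0]
    by (simp add: w[OF s0, symmetric] inner_add_right norm_eq_1 inner_commute)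
  then have "w \<noteq> 0" by auto
  then have "norm (w /\<^sub>R norm w) = 1" by simp
  moreover have "\<forall>s\<in>I. e1 s \<bullet> (w /\<^sub>R norm w) = c / norm w"
    using e1w by (simp add: divide_inverse)
  ultimately show "\<exists>d. norm d = 1 \<and> (\<exists>a. \<forall>s\<in>I. e1 s \<bullet> d = a)" by blast
qed

lemma equation_iff_proportional:
  assumes k1: "\<And>s. s \<in> I \<Longrightarrow> k1 s \<noteq> 0"
    and k1d: "\<And>s. s \<in> I \<Longrightarrow> k1 differentiable (at s within I)"
    and k2d: "\<And>s. s \<in> I \<Longrightarrow> k2 differentiable (at s within I)"
  shows "(\<forall>s\<in>I. deriv_on I (deriv_on I e2) s
        + (k1 s * deriv_on I (\<lambda>t. 1 / k1 t) s) *\<^sub>R deriv_on I e2 s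
        + ((k1 s)\<^sup>2 + (k2 s)\<^sup>2) *\<^sub>R e2 s = 0) \<longleftrightarrow> (\<exists>c. \<forall>s\<in>I. k2 s = c * k1 s)"
    (is "(\<forall>s\<in>I. ?E s = 0) \<longleftrightarrow> _")
proof -
  define p where "p s = deriv_on I k1 s" for s
  define q where "q s = deriv_on I k2 s" for s
  have p: "(k1 has_vector_derivative p s) (at s within I)" if "s \<in> I" for s
    unfolding p_def using has_vector_derivative_deriv_on[OF k1d[OF that]] .
  have q: "(k2 has_vector_derivative q s) (at s within I)" if "s \<in> I" for s
    unfolding q_def using has_vector_derivative_deriv_on[OF k2d[OF that]] .
  have ratio: "((\<lambda>t. k2 t / k1 t) has_vector_derivative
      (q s * k1 s - k2 s * p s) / (k1 s * k1 s)) (at s within I)" if "s \<in> I" for s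
    using DERIV_divide[of k2 "q s" s I k1 "p s"] p[OF that] q[OF that] k1[OF that]
    by (simp add: has_real_derivative_iff_has_vector_derivative)
  have D2: "deriv_on I e2 s = - k1 s *\<^sub>R e1 s + k2 s *\<^sub>R e3 s" if "s \<in> I" for s
    by (rule deriv_on_eqI[OF interval that e2'[OF that]])
  \<comment> \<open>the cancellation: only the \<open>e3\<close>-component survives\<close>
  have E: "?E s = (k1 s * ((q s * k1 s - k2 s * p s) / (k1 s * k1 s))) *\<^sub>R e3 s"
    if s: "s \<in> I" for s
  proof -
    have "((\<lambda>t. - k1 t *\<^sub>R e1 t + k2 t *\<^sub>R e3 t) has_vector_derivative
        ((- k1 s) *\<^sub>R k1 s *\<^sub>R e2 s + (- p s) *\<^sub>R e1 s)
        + (k2 s *\<^sub>R (- k2 s *\<^sub>R e2 s) + q s *\<^sub>R e3 s)) (at s within I)"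
      by (intro has_vector_derivative_add
          bounded_bilinear.has_vector_derivative[OF bounded_bilinear_scaleR]
          has_vector_derivative_minus p q e1' e3' s)
    then have "(deriv_on I e2 has_vector_derivative
        ((- k1 s) *\<^sub>R k1 s *\<^sub>R e2 s + (- p s) *\<^sub>R e1 s)
        + (k2 s *\<^sub>R (- k2 s *\<^sub>R e2 s) + q s *\<^sub>R e3 s)) (at s within I)"
      by (rule has_vector_derivative_transform[rotated 2]) (use D2 s in auto)
    then have DD: "deriv_on I (deriv_on I e2) s =
        ((- k1 s) *\<^sub>R k1 s *\<^sub>R e2 s + (- p s) *\<^sub>R e1 s)
        + (k2 s *\<^sub>R (- k2 s *\<^sub>R e2 s) + q s *\<^sub>R e3 s)"
      by (rule deriv_on_eqI[OF interval s])
    have "((\<lambda>t. 1 / k1 t) has_vector_derivative - p s / (k1 s * k1 s)) (at s within I)"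
      using DERIV_divide[of "\<lambda>_. 1" 0 s I k1 "p s"] p[OF s] k1[OF s]
      by (simp add: has_real_derivative_iff_has_vector_derivative)
    then have R: "deriv_on I (\<lambda>t. 1 / k1 t) s = - p s / (k1 s * k1 s)"
      by (rule deriv_on_eqI[OF interval s])
    have c1: "k1 s * (- p s / (k1 s * k1 s)) = - p s / k1 s"
      using k1[OF s] by simp
    have c3: "k1 s * ((q s * k1 s - k2 s * p s) / (k1 s * k1 s)) = q s - k2 s * p s / k1 s"
      using k1[OF s] by (simp add: field_simps)
    show ?thesis
      unfolding DD D2[OF s] R c1 c3 using k1[OF s]
      by (simp add: algebra_simps power2_eq_square)
  qed
  have "(\<forall>s\<in>I. ?E s = 0) \<longleftrightarrow> (\<forall>s\<in>I. (q s * k1 s - k2 s * p s) / (k1 s * k1 s) = 0)"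
  proof (rule ball_cong[OF refl])
    fix s assume s: "s \<in> I"
    have "e3 s \<noteq> 0" using unit(2)[OF s] by auto
    then show "?E s = 0 \<longleftrightarrow> (q s * k1 s - k2 s * p s) / (k1 s * k1 s) = 0"
      unfolding E[OF s] using k1[OF s] by simp
  qed
  also have "\<dots> \<longleftrightarrow> (\<exists>c. \<forall>s\<in>I. k2 s / k1 s = c)"
    by (rule constant_on_interval_iff_zero_derivative[OF interval ratio, symmetric])
  also have "\<dots> \<longleftrightarrow> (\<exists>c. \<forall>s\<in>I. k2 s = c * k1 s)"
    using k1 by (simp add: divide_eq_eq)
  finally show ?thesis .
qed

end

section \<open>Helices and constant inner products\<close>

text \<open>
  The inner product of two unit vectors lies in the interval \<open>[-1, 1]\<close>, on which \<open>arccos\<close> is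
  injective.
\<close>

lemma helix_of_iff_constant_inner:
  assumes unit: "\<And>s. s \<in> I \<Longrightarrow> norm (V s) = 1"
  shows "helix_of I V \<longleftrightarrow> (\<exists>d. norm d = 1 \<and> (\<exists>a. \<forall>s\<in>I. V s \<bullet> d = a))"
proof -
  have "(\<exists>\<theta>. \<forall>s\<in>I. angle_between (V s) d = \<theta>) \<longleftrightarrow> (\<exists>a. \<forall>s\<in>I. V s \<bullet> d = a)"
    if d: "norm d = 1" for d
  proof -
    have angle: "angle_between (V s) d = arccos (V s \<bullet> d)" if "s \<in> I" for s
      using unit[OF that] d by (simp add: angle_between_def)
    have cos: "cos (arccos (V s \<bullet> d)) = V s \<bullet> d" if "s \<in> I" for s
      using Cauchy_Schwarz_ineq2[of "V s" d] unit[OF that] d by (simp add: cos_arccos_abs)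
    show ?thesis using angle cos by metis
  qed
  then show ?thesis unfolding helix_of_def by blast
qed

section \<open>The frame of a Myller configuration\<close>

text \<open>
  Since \<open>K\<^sub>2 = \<xi>\<^sub>2' \<bullet> \<xi>\<^sub>3\<close>, the second derivative of \<open>\<xi>\<^sub>2\<close> is what makes \<open>K\<^sub>2\<close> differentiable.
  It exists because \<open>K\<^sub>1' = (\<xi>' \<bullet> \<xi>'') / K\<^sub>1\<close> is again differentiable, where \<open>K\<^sub>1 > 0\<close> keeps the
  norm away from its singularity.
\<close>

lemma curvature_and_xi2_regularity:
  fixes \<xi> :: "real \<Rightarrow> real^3"
  assumes I: "is_interval I" "interior I \<noteq> {}" and sm: "smooth_on I \<xi>"
    and K1: "\<And>s. s \<in> I \<Longrightarrow> K1 I \<xi> s \<noteq> 0" and s: "s \<in> I"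
  shows "K1 I \<xi> differentiable (at s within I)"
    and "xi2 I \<xi> differentiable (at s within I)"
    and "deriv_on I (xi2 I \<xi>) differentiable (at s within I)"
proof -
  define u where "u = deriv_on I \<xi>"
  define v where "v = deriv_on I u"
  have ud: "u differentiable (at t within I)" and vd: "v differentiable (at t within I)"
    if "t \<in> I" for t
    using sm[unfolded smooth_on_def, rule_format, of 1] sm[unfolded smooth_on_def, rule_format, of 2]
      that by (simp_all add: u_def v_def differentiable_on_def numeral_2_eq_2)
  have u': "(u has_vector_derivative v t) (at t within I)" if "t \<in> I" for t
    unfolding v_def by (rule has_vector_derivative_deriv_on[OF ud[OF that]])
  have u0: "u t \<noteq> 0" if "t \<in> I" for t
    using K1[OF that] by (simp add: K1_def u_def)
  have K1_eq: "K1 I \<xi> = (\<lambda>t. norm (u t))" by (auto simp: K1_def u_def)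
  have xi2_eq: "xi2 I \<xi> = (\<lambda>t. (1 / norm (u t)) *\<^sub>R u t)" by (auto simp: xi2_def K1_def u_def)
  have nd: "((\<lambda>t. norm (u t)) has_vector_derivative (u t \<bullet> v t) / norm (u t)) (at t within I)"
    if "t \<in> I" for t
    using has_derivative_compose[OF u'[OF that, unfolded has_vector_derivative_def]
        has_derivative_norm[OF u0[OF that]]]
    by (simp add: has_vector_derivative_def sgn_div_norm inner_commute divide_inverse mult_ac)
  then show K1d: "K1 I \<xi> differentiable (at s within I)"
    unfolding K1_eq using s by (meson differentiableI_vector)
  define r where "r t = - ((u t \<bullet> v t) / norm (u t)) / (norm (u t) * norm (u t))" for t
  have "((\<lambda>t. 1 / norm (u t)) has_vector_derivative r t) (at t within I)" if "t \<in> I" for t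
    using DERIV_divide[of "\<lambda>_. 1" 0 t I "\<lambda>t. norm (u t)" "(u t \<bullet> v t) / norm (u t)"]
      nd[OF that] u0[OF that]
    by (simp add: has_real_derivative_iff_has_vector_derivative r_def)
  then have X: "(xi2 I \<xi> has_vector_derivative (1 / norm (u t)) *\<^sub>R v t + r t *\<^sub>R u t) (at t within I)"
    if "t \<in> I" for t
    unfolding xi2_eq using u' that
    by (intro bounded_bilinear.has_vector_derivative[OF bounded_bilinear_scaleR]) auto
  then show "xi2 I \<xi> differentiable (at s within I)" using s by (meson differentiableI_vector)
  have eq: "deriv_on I (xi2 I \<xi>) t = (1 / norm (u t)) *\<^sub>R v t + r t *\<^sub>R u t" if "t \<in> I" for t
    by (rule deriv_on_eqI[OF I that X[OF that]])
  have nds: "(\<lambda>t. norm (u t)) differentiable (at s within I)"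
    using K1d unfolding K1_eq .
  have uv: "(\<lambda>t. u t \<bullet> v t) differentiable (at s within I)"
    using bounded_bilinear.has_vector_derivative[OF bounded_bilinear_inner
        has_vector_derivative_deriv_on[OF ud[OF s]] has_vector_derivative_deriv_on[OF vd[OF s]]]
    by (rule differentiableI_vector)
  have "(\<lambda>t. (1 / norm (u t)) *\<^sub>R v t + r t *\<^sub>R u t) differentiable (at s within I)"
    unfolding r_def using nds uv ud[OF s] vd[OF s] u0[OF s]
    by (intro differentiable_add differentiable_scaleR differentiable_divide
        differentiable_minus differentiable_mult) auto
  then show "deriv_on I (xi2 I \<xi>) differentiable (at s within I)"
    by (rule differentiable_transform_within[where d = 1]) (use s eq in auto)
qed

text \<open>
  The Frenet equations are stated for \<open>deriv_on\<close>, which is unspecified where no derivative exists;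
  here the three frame fields are shown to be differentiable, with those derivatives.
\<close>

lemma myller_frenet_frame:
  assumes M: "myller_configuration I r \<xi> \<pi>"
    and K1: "\<And>s. s \<in> I \<Longrightarrow> K1 I \<xi> s \<noteq> 0"
  shows "frenet_frame I \<xi> (xi2 I \<xi>) (xi3 I \<xi>) (K1 I \<xi>) (K2 I \<xi>)"
    and "\<And>s. s \<in> I \<Longrightarrow> K2 I \<xi> differentiable (at s within I)"
proof -
  have I: "is_interval I" "interior I \<noteq> {}" and sm: "smooth_on I \<xi>"
    using M by (auto simp: myller_configuration_def)
  have pos: "K1 I \<xi> s > 0" if "s \<in> I" for s
    using K1[OF that] by (simp add: K1_def)
  note F = frenet_equations[OF M pos]
  have d1: "\<xi> differentiable (at s within I)" if "s \<in> I" for s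
    using sm[unfolded smooth_on_def, rule_format, of 0] that by (simp add: differentiable_on_def)
  note d2 = curvature_and_xi2_regularity(2)[OF I sm K1]
  have d3: "xi3 I \<xi> differentiable (at s within I)" if "s \<in> I" for s
    unfolding xi3_def[abs_def]
    using bounded_bilinear.has_vector_derivative[OF
        bilinear_conv_bounded_bilinear[THEN iffD1, OF bilinear_cross]
        has_vector_derivative_deriv_on[OF d1[OF that]]
        has_vector_derivative_deriv_on[OF d2[OF _ that]]]
    by (meson differentiableI_vector)
  show "K2 I \<xi> differentiable (at s within I)" if "s \<in> I" for s
    unfolding K2_def[abs_def]
    using bounded_bilinear.has_vector_derivative[OF bounded_bilinear_inner
        has_vector_derivative_deriv_on[OF curvature_and_xi2_regularity(3)[OF I sm K1 that]]
        has_vector_derivative_deriv_on[OF d3[OF that]]]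
    by (meson differentiableI_vector)
  show "frenet_frame I \<xi> (xi2 I \<xi>) (xi3 I \<xi>) (K1 I \<xi>) (K2 I \<xi>)"
  proof
    show "is_interval I" "interior I \<noteq> {}" by (fact I)+
  next
    fix s and v :: "real^3" assume s: "s \<in> I"
    show "(\<xi> has_vector_derivative K1 I \<xi> s *\<^sub>R xi2 I \<xi> s) (at s within I)"
      using has_vector_derivative_deriv_on[OF d1[OF s]] F(1)[OF _ s] by simp
    show "(xi2 I \<xi> has_vector_derivative - K1 I \<xi> s *\<^sub>R \<xi> s + K2 I \<xi> s *\<^sub>R xi3 I \<xi> s)
        (at s within I)"
      using has_vector_derivative_deriv_on[OF d2[OF _ s]] F(2)[OF _ s] by simp
    show "(xi3 I \<xi> has_vector_derivative - K2 I \<xi> s *\<^sub>R xi2 I \<xi> s) (at s within I)"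
      using has_vector_derivative_deriv_on[OF d3[OF s]] F(3)[OF _ s] by simp
    show "norm (\<xi> s) = 1" "norm (xi3 I \<xi> s) = 1" "\<xi> s \<bullet> xi3 I \<xi> s = 0"
      using F(4,6,8)[OF _ s] by auto
    show "v = (v \<bullet> \<xi> s) *\<^sub>R \<xi> s + (v \<bullet> xi2 I \<xi> s) *\<^sub>R xi2 I \<xi> s + (v \<bullet> xi3 I \<xi> s) *\<^sub>R xi3 I \<xi> s"
      unfolding xi3_def
      by (rule orthonormal_expansion) (use F(4,5,7)[OF _ s] in \<open>auto simp: norm_eq_1\<close>)
  qed
qed

section \<open>Helices of a Myller configuration\<close>

theorem corollary22:
  fixes I :: "real set" and r \<xi> :: "real \<Rightarrow> real^3" and \<pi> :: "real \<Rightarrow> (real^3) set"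
  assumes "myller_configuration I r \<xi> \<pi>"
    and "\<And>s. s \<in> I \<Longrightarrow> K1 I \<xi> s \<noteq> 0"
    and "\<And>s. s \<in> I \<Longrightarrow> K2 I \<xi> s \<noteq> 0"
  shows "(helix_of I \<xi> \<longleftrightarrow> helix_of I (xi3 I \<xi>)) \<and>
    (helix_of I \<xi> \<longleftrightarrow>
      (\<forall>s\<in>I. deriv_on I (deriv_on I (xi2 I \<xi>)) s
        + (K1 I \<xi> s * deriv_on I (\<lambda>t. 1 / K1 I \<xi> t) s) *\<^sub>R deriv_on I (xi2 I \<xi>) s
        + ((K1 I \<xi> s)\<^sup>2 + (K2 I \<xi> s)\<^sup>2) *\<^sub>R xi2 I \<xi> s = 0))"
proof -
  have I: "is_interval I" "interior I \<noteq> {}" and sm: "smooth_on I \<xi>"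
    using assms(1) by (auto simp: myller_configuration_def)
  interpret A: frenet_frame I \<xi> "xi2 I \<xi>" "xi3 I \<xi>" "K1 I \<xi>" "K2 I \<xi>"
    using assms(1,2) by (rule myller_frenet_frame(1))
  interpret B: frenet_frame I "xi3 I \<xi>" "\<lambda>s. - xi2 I \<xi> s" \<xi> "K2 I \<xi>" "K1 I \<xi>"
    by (rule A.reversed_frame)
  have h1: "helix_of I \<xi> \<longleftrightarrow> (\<exists>c. \<forall>s\<in>I. K2 I \<xi> s = c * K1 I \<xi> s)"
    using helix_of_iff_constant_inner[OF A.unit(1)]
      A.constant_slope_iff_proportional[OF assms(2)] by simp
  have h3: "helix_of I (xi3 I \<xi>) \<longleftrightarrow> (\<exists>c. \<forall>s\<in>I. K1 I \<xi> s = c * K2 I \<xi> s)"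
    using helix_of_iff_constant_inner[OF A.unit(2)]
      B.constant_slope_iff_proportional[OF assms(3)] by simp
  have invert: "\<exists>c. \<forall>s\<in>I. f s = c * g s"
    if gf: "\<exists>c. \<forall>s\<in>I. g s = c * f s" and g: "\<And>s. s \<in> I \<Longrightarrow> g s \<noteq> 0" for f g :: "real \<Rightarrow> real"
  proof -
    obtain c where "\<forall>s\<in>I. g s = c * f s" using gf by blast
    then have "\<forall>s\<in>I. f s = inverse c * g s" using g by (fastforce simp: field_simps)
    then show ?thesis by blast
  qed
  have "(\<exists>c. \<forall>s\<in>I. K2 I \<xi> s = c * K1 I \<xi> s) \<longleftrightarrow> (\<exists>c. \<forall>s\<in>I. K1 I \<xi> s = c * K2 I \<xi> s)"
    using invert[of "K2 I \<xi>" "K1 I \<xi>"] invert[of "K1 I \<xi>" "K2 I \<xi>"] assms(2,3) by blast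
  moreover note A.equation_iff_proportional[OF assms(2)
      curvature_and_xi2_regularity(1)[OF I sm assms(2)] myller_frenet_frame(2)[OF assms(1,2)]]
  ultimately show ?thesis using h1 h3 by simp
qed

end
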